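(* Let $q>2$ be a prime power, $G=\mathrm{GL}_2(\mathbb F_q)$, and $P=\left\{\begin{pmatrix}1&y\\0&w\end{pmatrix}\;\middle|\; y\in\mathbb F_q,\ w\in\mathbb F_q^\times\right\}\le G$. Then \[\mathrm{Ind}_P^{G}(\mathbb 1_P)\cong \mathbb 1_{G}\oplus\rho_{\mathbb 1_q}\oplus\bigoplus_{\chi\in\widehat{\mathbb F_q^\times}\setminus\{\mathbb 1_q\}}\rho_{\chi,\mathbb 1_q}.\]
   Context: All representations are complex. $\mathbb 1_H$ denotes the trivial representation of a group $H$, and $\mathbb 1_q$ the trivial character of $\mathbb F_q^\times$; $\widehat{\mathbb F_q^\times}$ is the set of one-dimensional characters of $\mathbb F_q^\times$. Let $B\le G$ be the subgroup of upper triangular invertible matrices. For $\mu_1,\mu_2\in\widehat{\mathbb F_q^\times}$, let $\mu_{1,2}:B\to\mathbb C^\times$, $\mu_{1,2}\begin{pmatrix}u&w\\0&v\end{pmatrix}=\mu_1(u)\mu_2(v)$, and $\rho_{\mu_1,\mu_2}=\mathrm{Ind}_B^G(\mu_{1,2})$ (irreducible of dimension $q+1$ when $\mu_1\ne\mu_2$). For $\mu\in\widehat{\mathbb F_q^\times}$, $\det_\mu(X)=\mu(\det X)$ is a one-dimensional constituent of $\rho_{\mu,\mu}$, and $\rho_\mu$ denotes its complement in $\rho_{\mu,\mu}$ (an irreducible representation of dimension $q$); in particular $\rho_{\mathbb 1_q}$ is the $q$-dimensional irreducible constituent of $\mathrm{Ind}_B^G(\mathbb 1_B)$ other than the trivial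 one. *)

theory Defs
  imports "HOL-Analysis.Determinants"
begin

text \<open>A complex representation is modelled concretely: a space of complex-valued
  functions on some index type 'x (a C-subspace of 'x => complex) together with
  an action of group elements on it.\<close>
type_synonym ('g, 'x) crep = "('x \<Rightarrow> complex) set \<times> ('g \<Rightarrow> ('x \<Rightarrow> complex) \<Rightarrow> ('x \<Rightarrow> complex))"

text \<open>Isomorphism of representations of the group with carrier G: a C-linear
  bijection between the spaces intertwining the actions.\<close>
definition rep_iso :: "'g set \<Rightarrow> ('g, 'x) crep \<Rightarrow> ('g, 'y) crep \<Rightarrow> bool" where
  "rep_iso G R S \<longleftrightarrow> (\<exists>T.
      (\<forall>u\<in>fst R. \<forall>v\<in>fst R. \<forall>a b. T (\<lambda>x. a * u x + b * v x) = (\<lambda>y. a * T u y + b * T v y))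
    \<and> bij_betw T (fst R) (fst S)
    \<and> (\<forall>g\<in>G. \<forall>v\<in>fst R. T (snd R g v) = snd S g (T v)))"

text \<open>Trivial one-dimensional representation.\<close>
definition triv_rep :: "('g, unit) crep" where
  "triv_rep = (UNIV, (\<lambda>g f. f))"

text \<open>Binary direct sum.\<close>
definition dsum2 :: "('g, 'x) crep \<Rightarrow> ('g, 'y) crep \<Rightarrow> ('g, 'x + 'y) crep" where
  "dsum2 R S =
     ({h. (\<lambda>x. h (Inl x)) \<in> fst R \<and> (\<lambda>y. h (Inr y)) \<in> fst S},
      (\<lambda>g h z. case z of Inl x \<Rightarrow> snd R g (\<lambda>x. h (Inl x)) x
                       | Inr y \<Rightarrow> snd S g (\<lambda>y. h (Inr y)) y))"

text \<open>Direct sum of a family indexed by the (finite) set I.\<close>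
definition dsum_fam :: "'i set \<Rightarrow> ('i \<Rightarrow> ('g, 'x) crep) \<Rightarrow> ('g, 'i \<times> 'x) crep" where
  "dsum_fam I R =
     ({h. (\<forall>i\<in>I. (\<lambda>x. h (i, x)) \<in> fst (R i)) \<and> (\<forall>i x. i \<notin> I \<longrightarrow> h (i, x) = 0)},
      (\<lambda>g h ix. if fst ix \<in> I then snd (R (fst ix)) g (\<lambda>x. h (fst ix, x)) (snd ix) else 0))"

text \<open>Induced representation Ind_H^G(psi) of a one-dimensional character psi of H,
  in the standard model: functions f on G with f(h g) = psi(h) f(g), G acting by
  right translation.\<close>
definition ind_rep :: "'g set \<Rightarrow> ('g \<Rightarrow> 'g \<Rightarrow> 'g) \<Rightarrow> 'g set \<Rightarrow> ('g \<Rightarrow> complex) \<Rightarrow> ('g, 'g) crep" where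
  "ind_rep G m H psi =
     ({f. (\<forall>g. g \<notin> G \<longrightarrow> f g = 0) \<and> (\<forall>h\<in>H. \<forall>g\<in>G. f (m h g) = psi h * f g)},
      (\<lambda>x f g. f (m g x)))"

text \<open>GL_2 over a field and its subgroups. A \$ i \$ j is the (i,j) entry.\<close>
definition GL2 :: "('k::field ^ 2 ^ 2) set" where
  "GL2 = {A. det A \<noteq> 0}"

definition Borel :: "('k::field ^ 2 ^ 2) set" where
  "Borel = {A \<in> GL2. A $ 2 $ 1 = 0}"

definition Mirabolic :: "('k::field ^ 2 ^ 2) set" where
  "Mirabolic = {A \<in> GL2. A $ 1 $ 1 = 1 \<and> A $ 2 $ 1 = 0}"

text \<open>One-dimensional characters of F_q^x, extended by 0 at 0 (so they are
  determined by their values on F_q^x).\<close>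
definition fq_chars :: "('k::field \<Rightarrow> complex) set" where
  "fq_chars = {c. c 0 = 0 \<and> (\<forall>x. x \<noteq> 0 \<longrightarrow> c x \<noteq> 0)
                 \<and> (\<forall>x y. x \<noteq> 0 \<longrightarrow> y \<noteq> 0 \<longrightarrow> c (x * y) = c x * c y)}"

definition triv_char :: "'k::field \<Rightarrow> complex" where
  "triv_char x = (if x = 0 then 0 else 1)"

definition mu12 :: "('k::field \<Rightarrow> complex) \<Rightarrow> ('k \<Rightarrow> complex) \<Rightarrow> 'k ^ 2 ^ 2 \<Rightarrow> complex" where
  "mu12 \<mu>1 \<mu>2 A = \<mu>1 (A $ 1 $ 1) * \<mu>2 (A $ 2 $ 2)"

text \<open>rho_{mu1,mu2} = Ind_B^G(mu_{1,2}).\<close>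
definition rho_pair :: "('k::field \<Rightarrow> complex) \<Rightarrow> ('k \<Rightarrow> complex) \<Rightarrow> ('k ^ 2 ^ 2, 'k ^ 2 ^ 2) crep" where
  "rho_pair \<mu>1 \<mu>2 = ind_rep GL2 (**) Borel (mu12 \<mu>1 \<mu>2)"

text \<open>rho_mu: the complement of the line spanned by det_mu inside rho_{mu,mu},
  realised as the orthogonal complement w.r.t. the G-invariant inner product
  sum over g of f(g) * conj(h(g)).\<close>
definition rho_single :: "('k::{field,finite} \<Rightarrow> complex) \<Rightarrow> ('k ^ 2 ^ 2, 'k ^ 2 ^ 2) crep" where
  "rho_single \<mu> =
     ({f \<in> fst (rho_pair \<mu> \<mu>). (\<Sum>g\<in>GL2. f g * cnj (\<mu> (det g))) = 0}, snd (rho_pair \<mu> \<mu>))"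

end

theory Submission
  imports Defs "HOL-Algebra.Multiplicative_Group" "HOL-Analysis.Complex_Transcendental"
begin

(* The diagonal matrices diag(t,1) normalise the mirabolic subgroup P, and B = P {diag(t,1)}.
   Hence F_q^x acts on Ind_P^G 1 by (t.f)(g) = f(diag(t,1) g), commuting with the right action
   of G, and Ind_P^G 1 splits into the eigenspaces of this action. The phi-eigenspace consists
   of the f with f(b g) = phi(b_11) f(g) for b in B, i.e. it is rho_{phi,1}. The projections
   f |-> (1/(q-1)) sum_t phi(t)^-1 f(diag(t,1) g) onto the eigenspaces sum to the identity by
   orthogonality of the characters of the cyclic group F_q^x. Finally rho_{1,1} = 1 + rho_1 by
   splitting off the average over G. *)

section \<open>Characters of the multiplicative group of a finite field\<close>


lemma finite_field_units_cyclic: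
  "\<exists>m>0. \<exists>\<gamma>::'k::{field,finite}.
     (\<forall>x. x \<noteq> 0 \<longrightarrow> (\<exists>i. x = \<gamma> ^ i)) \<and> (\<forall>j. \<gamma> ^ j = 1 \<longleftrightarrow> m dvd j)"
proof -
  define R :: "'k ring" where "R = \<lparr>carrier = UNIV, mult = (*), one = 1, zero = 0, add = (+)\<rparr>"
  have "cring R"
  proof (rule cringI)
    show "abelian_group R" unfolding R_def
      by (rule abelian_groupI) (auto intro: left_minus)
    show "Group.comm_monoid R" unfolding R_def
      by (simp add: Group.monoid.intro monoid.monoid_comm_monoidI)
  qed (auto simp: R_def distrib_right)
  then have "field R"
    by (rule cring.field_intro2) (auto simp: R_def Units_def, metis left_inverse right_inverse)
  then interpret R: field R .
  interpret G: group "mult_of R" by (rule R.field_mult_group)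
  have pow: "x [^]\<^bsub>mult_of R\<^esub> n = x ^ n" for x and n :: nat
    by (induction n) (simp_all add: nat_pow_mult_of R_def)
  obtain \<gamma> where \<gamma>: "\<gamma> \<in> carrier (mult_of R)"
    "carrier (mult_of R) = {\<gamma> [^]\<^bsub>R\<^esub> i | i::nat. i \<in> UNIV}"
    using R.finite_field_mult_group_has_gen by (auto simp: R_def)
  have "G.ord \<gamma> > 0"
    using G.ord_ge_1[OF _ \<gamma>(1)] by (simp add: R_def)
  moreover have "\<exists>i. x = \<gamma> ^ i" if "x \<noteq> 0" for x
    using \<gamma>(2) that by (auto simp: R_def set_eq_iff pow[symmetric] nat_pow_mult_of)
  moreover have "\<gamma> ^ j = 1 \<longleftrightarrow> G.ord \<gamma> dvd j" for j
    using G.pow_eq_id[OF \<gamma>(1), of j] unfolding pow by (simp add: R_def)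
  ultimately show ?thesis
    by blast
qed

lemma fq_chars_mult: "c \<in> fq_chars \<Longrightarrow> x \<noteq> 0 \<Longrightarrow> y \<noteq> 0 \<Longrightarrow> c (x * y) = c x * c y"
  by (simp add: fq_chars_def)

lemma fq_chars_zero: "c \<in> fq_chars \<Longrightarrow> c 0 = 0"
  by (simp add: fq_chars_def)

lemma fq_chars_nonzero: "c \<in> fq_chars \<Longrightarrow> x \<noteq> 0 \<Longrightarrow> c x \<noteq> 0"
  by (simp add: fq_chars_def)

lemma fq_chars_one: "c \<in> fq_chars \<Longrightarrow> c 1 = 1"
  using fq_chars_mult[of c 1 1] fq_chars_nonzero[of c 1] by simp

lemma fq_chars_inverse: "c \<in> fq_chars \<Longrightarrow> x \<noteq> 0 \<Longrightarrow> c (inverse x) * c x = 1"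
  using fq_chars_mult[of c "inverse x" x] fq_chars_one[of c] by simp

lemma fq_chars_power: "c \<in> fq_chars \<Longrightarrow> x \<noteq> 0 \<Longrightarrow> c (x ^ n) = c x ^ n"
  by (induction n) (simp_all add: fq_chars_one fq_chars_mult)

lemma triv_char_fq_chars: "triv_char \<in> fq_chars"
  by (simp add: fq_chars_def triv_char_def)

lemma fq_chars_times: "c \<in> fq_chars \<Longrightarrow> d \<in> fq_chars \<Longrightarrow> (\<lambda>x. c x * d x) \<in> fq_chars"
  by (simp add: fq_chars_def)

lemma fq_chars_inverse_arg: "c \<in> fq_chars \<Longrightarrow> (\<lambda>x. c (inverse x)) \<in> fq_chars"
  by (simp add: fq_chars_def inverse_mult_distrib)

lemma fq_char_of_generator:
  fixes \<gamma> :: "'k::field" and z :: complex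
  assumes "m > 0" and gen: "\<And>x. x \<noteq> 0 \<Longrightarrow> \<exists>i. x = \<gamma> ^ i"
    and ord: "\<And>j. \<gamma> ^ j = 1 \<longleftrightarrow> m dvd j" and "z ^ m = 1"
  shows "\<exists>c\<in>fq_chars. \<forall>i. c (\<gamma> ^ i) = z ^ i"
proof -
  have "\<gamma> ^ m = 1"
    using ord by simp
  then have \<gamma>: "\<gamma> \<noteq> 0" and "z \<noteq> 0"
    using \<open>m > 0\<close> \<open>z ^ m = 1\<close> by (auto simp: zero_power)
  have well_defined: "z ^ a = z ^ b" if "\<gamma> ^ a = \<gamma> ^ b" "a \<le> b" for a b
  proof -
    have "\<gamma> ^ b = \<gamma> ^ a * \<gamma> ^ (b - a)"
      using that(2) by (simp flip: power_add)
    then have "m dvd b - a"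
      using that(1) \<gamma> ord[of "b - a"] by simp
    then obtain k where "b - a = m * k" ..
    then have "b = a + m * k"
      using \<open>a \<le> b\<close> by simp
    then show ?thesis
      using \<open>z ^ m = 1\<close> by (simp add: power_add power_mult)
  qed
  define c where "c x = (if x = 0 then 0 else z ^ (SOME i. x = \<gamma> ^ i))" for x
  have c_power: "c (\<gamma> ^ i) = z ^ i" for i
  proof -
    define j where "j = (SOME j. \<gamma> ^ i = \<gamma> ^ j)"
    have "\<gamma> ^ i = \<gamma> ^ j"
      unfolding j_def by (rule someI_ex) blast
    then have "z ^ i = z ^ j"
      using well_defined[of i j] well_defined[of j i] nat_le_linear[of i j] by metis
    then show ?thesis
      using \<gamma> by (simp add: c_def j_def)
  qed
  have "c \<in> fq_chars"
    unfolding fq_chars_def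
  proof (intro CollectI conjI allI impI)
    fix x y :: 'k assume "x \<noteq> 0"
    then show "c x \<noteq> 0"
      using \<open>z \<noteq> 0\<close> by (simp add: c_def)
    assume "y \<noteq> 0"
    obtain i j where "x = \<gamma> ^ i" "y = \<gamma> ^ j"
      using gen \<open>x \<noteq> 0\<close> \<open>y \<noteq> 0\<close> by metis
    then show "c (x * y) = c x * c y"
      by (simp add: c_power flip: power_add)
  qed (simp add: c_def)
  with c_power show ?thesis by blast
qed

lemma fq_chars_separate:
  assumes "(t::'k::{field,finite}) \<noteq> 0" "t \<noteq> 1"
  shows "\<exists>c\<in>fq_chars. c t \<noteq> 1"
proof -
  obtain \<gamma> :: 'k and m where m: "m > 0" and gen: "\<And>x. x \<noteq> 0 \<Longrightarrow> \<exists>i. x = \<gamma> ^ i"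
    and ord: "\<And>j. \<gamma> ^ j = 1 \<longleftrightarrow> m dvd j"
    using finite_field_units_cyclic by blast
  define \<zeta> :: complex where "\<zeta> = exp (2 * of_real pi * \<i> / of_nat m)"
  have \<zeta>_power: "\<zeta> ^ j = exp (2 * of_real pi * \<i> * of_nat j / of_nat m)" for j
    unfolding \<zeta>_def exp_of_nat_mult[symmetric] by (simp add: field_simps)
  have "\<zeta> ^ m = 1"
    using complex_root_unity[of m 1] m by (simp add: \<zeta>_power)
  then obtain c where c: "c \<in> fq_chars" "\<And>i. c (\<gamma> ^ i) = \<zeta> ^ i"
    using fq_char_of_generator[OF m gen ord] by blast
  obtain i where i: "t = \<gamma> ^ i"
    using gen assms(1) by blast
  then have "\<not> m dvd i"
    using assms(2) ord[of i] by simp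
  then have "c t \<noteq> 1"
    using complex_root_unity_eq_1[of m i] m by (simp add: c(2) i \<zeta>_power)
  with c(1) show ?thesis by blast
qed

lemma finite_fq_chars: "finite (fq_chars :: ('k::{field,finite} \<Rightarrow> complex) set)"
proof -
  obtain \<gamma> :: 'k and m where m: "m > 0" and gen: "\<And>x. x \<noteq> 0 \<Longrightarrow> \<exists>i. x = \<gamma> ^ i"
    and ord: "\<And>j. \<gamma> ^ j = 1 \<longleftrightarrow> m dvd j"
    using finite_field_units_cyclic by blast
  have "\<gamma> ^ m = 1"
    using ord by simp
  then have \<gamma>: "\<gamma> \<noteq> 0"
    using m by (auto simp: zero_power)
  have inj: "inj_on (\<lambda>c. c \<gamma>) fq_chars"
  proof (rule inj_onI, rule ext)
    fix c d :: "'k \<Rightarrow> complex" and x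
    assume c: "c \<in> fq_chars" and d: "d \<in> fq_chars" and "c \<gamma> = d \<gamma>"
    show "c x = d x"
    proof (cases "x = 0")
      case True
      then show ?thesis by (simp add: fq_chars_zero c d)
    next
      case False
      then obtain i where "x = \<gamma> ^ i" using gen by blast
      then show ?thesis
        using \<open>c \<gamma> = d \<gamma>\<close> by (simp add: fq_chars_power c d \<gamma>)
    qed
  qed
  have "(\<lambda>c. c \<gamma>) ` fq_chars \<subseteq> {z. z ^ m = 1}"
  proof (intro image_subsetI CollectI)
    fix c :: "'k \<Rightarrow> complex" assume "c \<in> fq_chars"
    then show "c \<gamma> ^ m = 1"
      using \<open>\<gamma> ^ m = 1\<close> \<gamma> by (metis fq_chars_one fq_chars_power)
  qed
  then have "finite ((\<lambda>c. c \<gamma>) ` fq_chars)"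
    using finite_roots_unity[of m] m by (auto intro: finite_subset)
  then show ?thesis
    using inj by (rule finite_imageD)
qed

lemma sum_fq_chars:
  "(\<Sum>c\<in>fq_chars. c (t::'k::{field,finite})) = (if t = 1 then of_nat (card (fq_chars :: ('k \<Rightarrow> complex) set)) else 0)"
proof (cases "t = 0 \<or> t = 1")
  case True
  then show ?thesis by (auto simp: fq_chars_zero fq_chars_one)
next
  case False
  then obtain \<psi> where \<psi>: "\<psi> \<in> fq_chars" "\<psi> t \<noteq> 1"
    using fq_chars_separate by blast
  have cancel: "\<psi> (inverse x) * (\<psi> x * c x) = c x" "\<psi> x * (\<psi> (inverse x) * c x) = c x"
    if "c \<in> fq_chars" for c x
  proof -
    have "\<psi> (inverse x) * \<psi> x * c x = c x"
      using fq_chars_inverse[OF \<psi>(1), of x] fq_chars_zero[OF that] by (cases "x = 0") simp_all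
    then show "\<psi> (inverse x) * (\<psi> x * c x) = c x" "\<psi> x * (\<psi> (inverse x) * c x) = c x"
      by (simp_all only: ac_simps)
  qed
  have "(\<Sum>c\<in>fq_chars. c t) = (\<Sum>c\<in>fq_chars. \<psi> t * c t)"
    by (rule sum.reindex_bij_witness[of _ "\<lambda>c x. \<psi> x * c x" "\<lambda>c x. \<psi> (inverse x) * c x"])
      (simp_all add: cancel fq_chars_times fq_chars_inverse_arg \<psi>(1))
  also have "\<dots> = \<psi> t * (\<Sum>c\<in>fq_chars. c t)"
    by (rule sum_distrib_left[symmetric])
  finally have "\<psi> t * (\<Sum>c\<in>fq_chars. c t) = (\<Sum>c\<in>fq_chars. c t)"
    by (rule sym)
  then show ?thesis
    using \<psi>(2) False by simp
qed

lemma sum_units_fq_chars_orthogonal: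
  assumes c: "c \<in> fq_chars" and d: "d \<in> fq_chars"
  shows "(\<Sum>t\<in>{t::'k::{field,finite}. t \<noteq> 0}. c (inverse t) * d t)
    = (if c = d then of_nat (card {t::'k. t \<noteq> 0}) else 0)"
proof (cases "c = d")
  case True
  then show ?thesis
    using fq_chars_inverse[OF c] by simp
next
  case False
  then obtain s where "c s \<noteq> d s"
    by blast
  then have s: "s \<noteq> 0"
    using fq_chars_zero[OF c] fq_chars_zero[OF d] by auto
  let ?U = "{t::'k. t \<noteq> 0}"
  have "(\<Sum>t\<in>?U. c (inverse t) * d t) = (\<Sum>t\<in>?U. c (inverse (s * t)) * d (s * t))"
    by (rule sum.reindex_bij_witness[of _ "\<lambda>t. s * t" "\<lambda>t. t / s"]) (simp_all add: s)
  also have "\<dots> = c (inverse s) * d s * (\<Sum>t\<in>?U. c (inverse t) * d t)"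
    unfolding sum_distrib_left
    by (rule sum.cong) (simp_all add: s inverse_mult_distrib fq_chars_mult[OF c] fq_chars_mult[OF d] ac_simps)
  finally have scaled: "c (inverse s) * d s * (\<Sum>t\<in>?U. c (inverse t) * d t) = (\<Sum>t\<in>?U. c (inverse t) * d t)"
    by (rule sym)
  have "c (inverse s) * d s \<noteq> 1"
  proof
    assume "c (inverse s) * d s = 1"
    then have "c (inverse s) * d s = c (inverse s) * c s"
      using fq_chars_inverse[OF c s] by simp
    then show False
      using fq_chars_nonzero[OF c, of "inverse s"] s \<open>c s \<noteq> d s\<close> by simp
  qed
  then show ?thesis
    using scaled False by simp
qed

lemma card_fq_chars: "card (fq_chars :: ('k::{field,finite} \<Rightarrow> complex) set) = card {t::'k. t \<noteq> 0}"
proof -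
  let ?U = "{t::'k. t \<noteq> 0}"
  have "of_nat (card (fq_chars :: ('k \<Rightarrow> complex) set)) = (\<Sum>t\<in>?U. \<Sum>c\<in>fq_chars. c t)"
    by (simp add: sum_fq_chars)
  also have "\<dots> = (\<Sum>c\<in>fq_chars. \<Sum>t\<in>?U. triv_char (inverse t) * c t)"
    by (subst sum.swap) (simp add: triv_char_def)
  also have "\<dots> = (of_nat (card ?U) :: complex)"
    by (simp add: sum_units_fq_chars_orthogonal triv_char_fq_chars finite_fq_chars)
  finally show ?thesis
    by (simp only: of_nat_eq_iff)
qed

section \<open>Matrices in GL(2)\<close>

definition mat2 :: "'k::field \<Rightarrow> 'k \<Rightarrow> 'k \<Rightarrow> 'k \<Rightarrow> 'k^2^2" where
  "mat2 a b c d = (\<chi> i j. if i = 1 then (if j = 1 then a else b) else (if j = 1 then c else d))"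

lemma mat2_nth [simp]:
  "mat2 a b c d $ 1 $ 1 = a" "mat2 a b c d $ 1 $ 2 = b" "mat2 a b c d $ 2 $ 1 = c" "mat2 a b c d $ 2 $ 2 = d"
  by (simp_all add: mat2_def)

lemma mat2_eta: "A = mat2 (A $ 1 $ 1) (A $ 1 $ 2) (A $ 2 $ 1) (A $ 2 $ 2)"
  by (simp add: vec_eq_iff forall_2)

lemma mat2_mult:
  "mat2 a b c d ** mat2 a' b' c' d' = mat2 (a * a' + b * c') (a * b' + b * d') (c * a' + d * c') (c * b' + d * d')"
  by (simp add: vec_eq_iff forall_2 matrix_matrix_mult_def sum_2)

lemma det_mat2: "det (mat2 a b c d) = a * d - b * c"
  by (simp add: det_2)

definition diag1 :: "'k::field \<Rightarrow> 'k^2^2" where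
  "diag1 t = mat2 t 0 0 1"

lemma GL2_mult: "A \<in> GL2 \<Longrightarrow> B \<in> GL2 \<Longrightarrow> A ** B \<in> GL2"
  by (simp add: GL2_def det_mul)

lemma GL2_mult_left_iff: "A \<in> GL2 \<Longrightarrow> A ** B \<in> GL2 \<longleftrightarrow> B \<in> GL2"
  by (simp add: GL2_def det_mul)

lemma GL2_mult_right_iff: "B \<in> GL2 \<Longrightarrow> A ** B \<in> GL2 \<longleftrightarrow> A \<in> GL2"
  by (simp add: GL2_def det_mul)

lemma GL2_inverse:
  assumes "A \<in> GL2"
  obtains B where "B \<in> GL2" "A ** B = mat 1" "B ** A = mat 1"
proof -
  obtain B where B: "A ** B = mat 1" "B ** A = mat 1"
    using assms by (auto simp: GL2_def simp flip: invertible_det_nz elim: invertible_def[THEN iffD1, elim_format])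
  then have "det A * det B = 1"
    by (metis det_I det_mul)
  then have "B \<in> GL2"
    by (auto simp: GL2_def)
  with B that show thesis
    by blast
qed

lemma sum_GL2_mult_right:
  assumes "(X::'k::{field,finite}^2^2) \<in> GL2"
  shows "(\<Sum>g\<in>GL2. f (g ** X)) = (\<Sum>g\<in>GL2. f g)"
proof -
  obtain Y where "Y \<in> GL2" "X ** Y = mat 1" "Y ** X = mat 1"
    using assms by (rule GL2_inverse)
  then show ?thesis
    by (intro sum.reindex_bij_witness[of _ "\<lambda>g. g ** Y" "\<lambda>g. g ** X"])
       (simp_all add: matrix_mul_assoc[symmetric] GL2_mult assms)
qed

lemma sum_GL2_mult_left:
  assumes "(X::'k::{field,finite}^2^2) \<in> GL2"
  shows "(\<Sum>g\<in>GL2. f (X ** g)) = (\<Sum>g\<in>GL2. f g)"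
proof -
  obtain Y where "Y \<in> GL2" "X ** Y = mat 1" "Y ** X = mat 1"
    using assms by (rule GL2_inverse)
  then show ?thesis
    by (intro sum.reindex_bij_witness[of _ "\<lambda>g. Y ** g" "\<lambda>g. X ** g"])
       (simp_all add: matrix_mul_assoc GL2_mult assms)
qed

lemma diag1_GL2: "t \<noteq> 0 \<Longrightarrow> diag1 t \<in> GL2"
  by (simp add: GL2_def diag1_def det_mat2)

lemma diag1_Borel: "t \<noteq> 0 \<Longrightarrow> diag1 t \<in> Borel"
  by (simp add: Borel_def diag1_GL2) (simp add: diag1_def)

lemma diag1_one: "diag1 1 = mat 1"
  by (simp add: diag1_def vec_eq_iff forall_2 mat_def)

lemma Mirabolic_subset_Borel: "Mirabolic \<subseteq> Borel"
  by (auto simp: Mirabolic_def Borel_def)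

lemma Borel_subset_GL2: "Borel \<subseteq> GL2"
  by (auto simp: Borel_def)

lemma Borel_diag_nonzero: "B \<in> Borel \<Longrightarrow> B $ 1 $ 1 \<noteq> 0 \<and> B $ 2 $ 2 \<noteq> 0"
  by (auto simp: Borel_def GL2_def det_2)

lemma diag1_mult_Borel:
  assumes "B \<in> Borel" and "t \<noteq> 0"
  obtains P where "P \<in> Mirabolic" "diag1 t ** B = P ** diag1 (t * B $ 1 $ 1)"
proof
  show "mat2 1 (t * B $ 1 $ 2) 0 (B $ 2 $ 2) \<in> Mirabolic"
    using Borel_diag_nonzero[OF assms(1)] by (simp add: Mirabolic_def GL2_def det_mat2)
  have "B $ 2 $ 1 = 0"
    using assms(1) by (simp add: Borel_def)
  then show "diag1 t ** B = mat2 1 (t * B $ 1 $ 2) 0 (B $ 2 $ 2) ** diag1 (t * B $ 1 $ 1)"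
    by (subst (1) mat2_eta[of B]) (simp add: diag1_def mat2_mult)
qed

lemma card_units_nonzero: "card {t::'k::{field,finite}. t \<noteq> 0} \<noteq> 0"
proof -
  have "(1::'k) \<in> {t. t \<noteq> 0}"
    by simp
  then show ?thesis
    by (metis card_0_eq empty_iff finite)
qed

lemma card_GL2_nonzero: "card (GL2 :: ('k::{field,finite}^2^2) set) \<noteq> 0"
proof -
  have "mat 1 \<in> (GL2 :: ('k^2^2) set)"
    by (simp add: GL2_def)
  then show ?thesis
    by (metis card_0_eq empty_iff finite)
qed

section \<open>Eigenprojections for the diagonal torus\<close>

abbreviation mirabolic_rep :: "('k::{field,finite}^2^2, 'k^2^2) crep" where
  "mirabolic_rep \<equiv> ind_rep GL2 (**) Mirabolic (\<lambda>_. 1)"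

lemma mem_ind_rep_iff:
  "f \<in> fst (ind_rep G m H \<psi>) \<longleftrightarrow>
    (\<forall>g. g \<notin> G \<longrightarrow> f g = 0) \<and> (\<forall>h\<in>H. \<forall>g\<in>G. f (m h g) = \<psi> h * f g)"
  by (simp add: ind_rep_def)

lemma ind_rep_lincomb:
  "u \<in> fst (ind_rep G m H \<psi>) \<Longrightarrow> v \<in> fst (ind_rep G m H \<psi>) \<Longrightarrow>
    (\<lambda>g. a * u g + b * v g) \<in> fst (ind_rep G m H \<psi>)"
  by (simp add: mem_ind_rep_iff algebra_simps)

lemma rho_pair_diag1:
  assumes k: "k \<in> fst (rho_pair \<psi> triv_char)" and t: "t \<noteq> 0"
  shows "k (diag1 t ** g) = \<psi> t * k g"
proof (cases "g \<in> GL2")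
  case True
  moreover have "mu12 \<psi> triv_char (diag1 t) = \<psi> t"
    by (simp add: mu12_def diag1_def triv_char_def)
  ultimately show ?thesis
    using k diag1_Borel[OF t] by (simp add: rho_pair_def mem_ind_rep_iff)
next
  case False
  then show ?thesis
    using k GL2_mult_left_iff[OF diag1_GL2[OF t]] by (simp add: rho_pair_def mem_ind_rep_iff)
qed

lemma rho_pair_Mirabolic_invariant:
  assumes k: "k \<in> fst (rho_pair \<psi> triv_char)" and "\<psi> \<in> fq_chars" and "P \<in> Mirabolic" and "g \<in> GL2"
  shows "k (P ** g) = k g"
proof -
  have "P \<in> Borel"
    using assms(3) Mirabolic_subset_Borel by blast
  moreover from this have "mu12 \<psi> triv_char P = 1"
    using assms(2,3) Borel_diag_nonzero[of P] by (simp add: mu12_def triv_char_def Mirabolic_def fq_chars_one)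
  ultimately show ?thesis
    using k \<open>g \<in> GL2\<close> by (simp add: rho_pair_def mem_ind_rep_iff)
qed

lemma GL2_indicator_rho_pair: "(\<lambda>g. of_bool (g \<in> GL2)) \<in> fst (rho_pair triv_char triv_char)"
  using Borel_subset_GL2 Borel_diag_nonzero
  by (auto simp: rho_pair_def mem_ind_rep_iff mu12_def triv_char_def GL2_mult)

definition torus_proj ::
  "('k::{field,finite} \<Rightarrow> complex) \<Rightarrow> ('k^2^2 \<Rightarrow> complex) \<Rightarrow> 'k^2^2 \<Rightarrow> complex" where
  "torus_proj \<phi> f g =
     (\<Sum>t\<in>{t. t \<noteq> 0}. \<phi> (inverse t) * f (diag1 t ** g)) / of_nat (card {t::'k. t \<noteq> 0})"

lemma torus_proj_mult_right: "torus_proj \<phi> (\<lambda>g. f (g ** X)) g = torus_proj \<phi> f (g ** X)"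
  by (simp add: torus_proj_def matrix_mul_assoc)

lemma torus_proj_add: "torus_proj \<phi> (\<lambda>g. u g + v g) g = torus_proj \<phi> u g + torus_proj \<phi> v g"
  by (simp add: torus_proj_def sum.distrib distrib_left add_divide_distrib)

lemma torus_proj_cmult: "torus_proj \<phi> (\<lambda>g. a * u g) g = a * torus_proj \<phi> u g"
  by (simp add: torus_proj_def sum_distrib_left ac_simps)

lemma torus_proj_sum: "torus_proj \<phi> (\<lambda>g. \<Sum>i\<in>I. u i g) g = (\<Sum>i\<in>I. torus_proj \<phi> (u i) g)"
  by (simp add: torus_proj_def sum_distrib_left sum_divide_distrib sum.swap[of _ I])

lemma torus_proj_rho_pair:
  fixes f :: "'k::{field,finite}^2^2 \<Rightarrow> complex"
  assumes f: "f \<in> fst mirabolic_rep" and \<phi>: "\<phi> \<in> fq_chars"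
  shows "torus_proj \<phi> f \<in> fst (rho_pair \<phi> triv_char)"
  unfolding rho_pair_def mem_ind_rep_iff
proof (intro conjI allI impI ballI)
  fix g :: "'k^2^2"
  assume "g \<notin> GL2"
  then have "f (diag1 t ** g) = 0" if "t \<noteq> 0" for t
    using f GL2_mult_left_iff[OF diag1_GL2[OF that]] by (simp add: mem_ind_rep_iff)
  then show "torus_proj \<phi> f g = 0"
    by (simp add: torus_proj_def)
next
  fix B g :: "'k^2^2"
  assume B: "B \<in> Borel" and g: "g \<in> GL2"
  define a where "a = B $ 1 $ 1"
  have a: "a \<noteq> 0"
    using Borel_diag_nonzero[OF B] by (simp add: a_def)
  have shift: "f (diag1 t ** (B ** g)) = f (diag1 (t * a) ** g)" if t: "t \<noteq> 0" for t
  proof -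
    obtain P where P: "P \<in> Mirabolic" "diag1 t ** B = P ** diag1 (t * a)"
      by (rule diag1_mult_Borel[OF B t, folded a_def])
    then have "diag1 t ** (B ** g) = P ** (diag1 (t * a) ** g)"
      by (simp add: matrix_mul_assoc)
    moreover have "diag1 (t * a) ** g \<in> GL2"
      using a t by (intro GL2_mult diag1_GL2 g) simp
    ultimately show ?thesis
      using f P(1) by (simp add: mem_ind_rep_iff)
  qed
  let ?U = "{t::'k. t \<noteq> 0}"
  have "(\<Sum>t\<in>?U. \<phi> (inverse t) * f (diag1 t ** (B ** g)))
      = (\<Sum>t\<in>?U. \<phi> (inverse t) * f (diag1 (t * a) ** g))"
    by (rule sum.cong) (simp_all add: shift)
  also have "\<dots> = (\<Sum>s\<in>?U. \<phi> (inverse (s / a)) * f (diag1 s ** g))"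
    by (rule sum.reindex_bij_witness[of _ "\<lambda>s. s / a" "\<lambda>t. t * a"]) (simp_all add: a)
  also have "\<dots> = \<phi> a * (\<Sum>s\<in>?U. \<phi> (inverse s) * f (diag1 s ** g))"
    unfolding sum_distrib_left
    by (rule sum.cong) (simp_all add: a divide_inverse fq_chars_mult[OF \<phi>] ac_simps)
  finally have "torus_proj \<phi> f (B ** g) = \<phi> a * torus_proj \<phi> f g"
    by (simp add: torus_proj_def)
  moreover have "mu12 \<phi> triv_char B = \<phi> a"
    using Borel_diag_nonzero[OF B] by (simp add: mu12_def triv_char_def a_def)
  ultimately show "torus_proj \<phi> f (B ** g) = mu12 \<phi> triv_char B * torus_proj \<phi> f g"
    by simp
qed

lemma torus_proj_on_rho_pair:
  fixes k :: "'k::{field,finite}^2^2 \<Rightarrow> complex"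
  assumes k: "k \<in> fst (rho_pair \<psi> triv_char)" and "\<psi> \<in> fq_chars" and "\<phi> \<in> fq_chars"
  shows "torus_proj \<phi> k = (if \<phi> = \<psi> then k else (\<lambda>_. 0))"
proof
  fix g
  have "(\<Sum>t\<in>{t. t \<noteq> 0}. \<phi> (inverse t) * k (diag1 t ** g))
      = (\<Sum>t\<in>{t. t \<noteq> 0}. \<phi> (inverse t) * \<psi> t) * k g"
    unfolding sum_distrib_right by (rule sum.cong) (simp_all add: rho_pair_diag1[OF k])
  then show "torus_proj \<phi> k g = (if \<phi> = \<psi> then k else (\<lambda>_. 0)) g"
    using card_units_nonzero[where 'k='k]
    by (simp add: torus_proj_def sum_units_fq_chars_orthogonal assms)
qed

lemma sum_torus_proj: "(\<Sum>\<phi>\<in>fq_chars. torus_proj \<phi> f g) = f (g::'k::{field,finite}^2^2)"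
proof -
  let ?U = "{t::'k. t \<noteq> 0}"
  have "(\<Sum>\<phi>\<in>fq_chars. \<Sum>t\<in>?U. \<phi> (inverse t) * f (diag1 t ** g))
      = (\<Sum>t\<in>?U. (\<Sum>\<phi>\<in>fq_chars. \<phi> (inverse t)) * f (diag1 t ** g))"
    by (subst sum.swap) (simp add: sum_distrib_right)
  also have "\<dots> = (\<Sum>t\<in>?U. if t = 1 then of_nat (card ?U) * f g else 0)"
    by (rule sum.cong) (simp_all add: sum_fq_chars card_fq_chars diag1_one)
  also have "\<dots> = of_nat (card ?U) * f g"
    by simp
  finally show ?thesis
    using card_units_nonzero[where 'k='k] by (simp add: torus_proj_def flip: sum_divide_distrib)
qed

lemma sum_GL2_torus_proj_triv:
  "(\<Sum>g\<in>GL2. torus_proj triv_char f g) = (\<Sum>g\<in>GL2. f (g::'k::{field,finite}^2^2))"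
proof -
  let ?U = "{t::'k. t \<noteq> 0}"
  have "(\<Sum>g\<in>GL2. \<Sum>t\<in>?U. triv_char (inverse t) * f (diag1 t ** g)) = (\<Sum>t\<in>?U. \<Sum>g\<in>GL2. f (diag1 t ** g))"
    by (subst sum.swap) (simp add: triv_char_def)
  also have "\<dots> = of_nat (card ?U) * (\<Sum>g\<in>GL2. f g)"
    by (simp add: sum_GL2_mult_left diag1_GL2)
  finally show ?thesis
    using card_units_nonzero[where 'k='k] by (simp add: torus_proj_def flip: sum_divide_distrib)
qed

lemma sum_GL2_rho_pair_nontriv:
  fixes k :: "'k::{field,finite}^2^2 \<Rightarrow> complex"
  assumes "k \<in> fst (rho_pair \<psi> triv_char)" "\<psi> \<in> fq_chars" "\<psi> \<noteq> triv_char"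
  shows "(\<Sum>g\<in>GL2. k g) = 0"
  using sum_GL2_torus_proj_triv[of k] torus_proj_on_rho_pair[OF assms(1,2) triv_char_fq_chars] assms(3)
  by simp

section \<open>The isomorphism\<close>

type_synonym 'k principal_index = "unit + ('k^2^2 + ('k \<Rightarrow> complex) \<times> ('k^2^2))"

abbreviation principal_sum :: "('k::{field,finite}^2^2, 'k principal_index) crep" where
  "principal_sum \<equiv> dsum2 triv_rep
     (dsum2 (rho_single triv_char) (dsum_fam (fq_chars - {triv_char}) (\<lambda>\<phi>. rho_pair \<phi> triv_char)))"

lemma mem_principal_sum_iff:
  "y \<in> fst principal_sum \<longleftrightarrow>
     (\<lambda>g. y (Inr (Inl g))) \<in> fst (rho_pair triv_char triv_char) \<and> (\<Sum>g\<in>GL2. y (Inr (Inl g))) = 0 \<and>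
     (\<forall>\<phi>\<in>fq_chars - {triv_char}. (\<lambda>g. y (Inr (Inr (\<phi>, g)))) \<in> fst (rho_pair \<phi> triv_char)) \<and>
     (\<forall>\<phi> g. \<phi> \<notin> fq_chars - {triv_char} \<longrightarrow> y (Inr (Inr (\<phi>, g))) = 0)"
proof -
  have "(\<Sum>g\<in>GL2. y (Inr (Inl g)) * cnj (triv_char (det g))) = (\<Sum>g\<in>GL2. y (Inr (Inl g)))"
    by (rule sum.cong) (simp_all add: triv_char_def GL2_def)
  then show ?thesis
    by (auto simp: dsum2_def dsum_fam_def triv_rep_def rho_single_def)
qed

definition GL2_average :: "('k::{field,finite}^2^2 \<Rightarrow> complex) \<Rightarrow> complex" where
  "GL2_average f = (\<Sum>g\<in>GL2. f g) / of_nat (card (GL2 :: ('k^2^2) set))"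

fun decompose ::
  "('k::{field,finite}^2^2 \<Rightarrow> complex) \<Rightarrow> 'k principal_index \<Rightarrow> complex" where
  "decompose f (Inl _) = GL2_average f"
| "decompose f (Inr (Inl g)) = torus_proj triv_char f g - GL2_average f * of_bool (g \<in> GL2)"
| "decompose f (Inr (Inr (\<phi>, g))) = (if \<phi> \<in> fq_chars - {triv_char} then torus_proj \<phi> f g else 0)"

definition recompose ::
  "('k::{field,finite} principal_index \<Rightarrow> complex) \<Rightarrow> 'k^2^2 \<Rightarrow> complex" where
  "recompose y g = y (Inl ()) * of_bool (g \<in> GL2) + y (Inr (Inl g))
     + (\<Sum>\<phi>\<in>fq_chars - {triv_char}. y (Inr (Inr (\<phi>, g))))"

lemma decompose_linear:
  "decompose (\<lambda>x. a * u x + b * v x) = (\<lambda>z. a * decompose u z + b * decompose v z)"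
proof
  fix z
  show "decompose (\<lambda>x. a * u x + b * v x) z = a * decompose u z + b * decompose v z"
    by (cases "(u, z)" rule: decompose.cases)
      (simp_all add: GL2_average_def torus_proj_add torus_proj_cmult sum.distrib sum_distrib_left
        add_divide_distrib algebra_simps)
qed

lemma decompose_equivariant:
  assumes "X \<in> GL2"
  shows "decompose (snd mirabolic_rep X f) = snd principal_sum X (decompose f)"
proof
  fix z
  have "GL2_average (\<lambda>g. f (g ** X)) = GL2_average f"
    using sum_GL2_mult_right[OF assms, of f] by (simp add: GL2_average_def)
  then show "decompose (snd mirabolic_rep X f) z = snd principal_sum X (decompose f) z"
    by (cases "(f, z)" rule: decompose.cases)
      (simp_all add: ind_rep_def dsum2_def dsum_fam_def triv_rep_def rho_single_def rho_pair_def
        torus_proj_mult_right GL2_mult_right_iff[OF assms])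
qed

lemma decompose_mem:
  fixes f :: "'k::{field,finite}^2^2 \<Rightarrow> complex"
  assumes f: "f \<in> fst mirabolic_rep"
  shows "decompose f \<in> fst principal_sum"
  unfolding mem_principal_sum_iff
proof (intro conjI ballI allI impI)
  have proj: "torus_proj triv_char f \<in> fst (rho_pair triv_char triv_char)"
    by (rule torus_proj_rho_pair[OF f triv_char_fq_chars])
  show "(\<lambda>g. decompose f (Inr (Inl g))) \<in> fst (rho_pair triv_char triv_char)"
    using ind_rep_lincomb[OF proj[unfolded rho_pair_def] GL2_indicator_rho_pair[unfolded rho_pair_def],
        of 1 "- GL2_average f"]
    by (simp add: rho_pair_def)
  show "(\<Sum>g\<in>GL2. decompose f (Inr (Inl g))) = 0"
    using card_GL2_nonzero[where 'k='k]
    by (simp add: sum_subtractf sum_GL2_torus_proj_triv GL2_average_def flip: sum_distrib_right)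
  show "(\<lambda>g. decompose f (Inr (Inr (\<phi>, g)))) \<in> fst (rho_pair \<phi> triv_char)"
    if "\<phi> \<in> fq_chars - {triv_char}" for \<phi>
    using torus_proj_rho_pair[OF f] that by simp
  show "decompose f (Inr (Inr (\<phi>, g))) = 0" if "\<phi> \<notin> fq_chars - {triv_char}" for \<phi> g
    using that by auto
qed

lemma recompose_decompose: "recompose (decompose f) = f"
proof
  fix g
  have "recompose (decompose f) g
      = torus_proj triv_char f g + (\<Sum>\<phi>\<in>fq_chars - {triv_char}. torus_proj \<phi> f g)"
    by (simp add: recompose_def)
  also have "\<dots> = (\<Sum>\<phi>\<in>fq_chars. torus_proj \<phi> f g)"
    by (simp add: sum.remove[OF finite_fq_chars triv_char_fq_chars])
  finally show "recompose (decompose f) g = f g"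
    by (simp add: sum_torus_proj)
qed

lemma recompose_mem:
  assumes y: "y \<in> fst principal_sum"
  shows "recompose y \<in> fst mirabolic_rep"
proof -
  have h: "(\<lambda>g. y (Inr (Inl g))) \<in> fst (rho_pair triv_char triv_char)"
    and k: "\<And>\<phi>. \<phi> \<in> fq_chars - {triv_char} \<Longrightarrow>
      (\<lambda>g. y (Inr (Inr (\<phi>, g)))) \<in> fst (rho_pair \<phi> triv_char)"
    using y by (simp_all add: mem_principal_sum_iff)
  have "recompose y g = 0" if "g \<notin> GL2" for g
    using h k that by (simp add: recompose_def rho_pair_def mem_ind_rep_iff)
  moreover have "recompose y (P ** g) = recompose y g" if "P \<in> Mirabolic" "g \<in> GL2" for P g
    using rho_pair_Mirabolic_invariant[OF GL2_indicator_rho_pair triv_char_fq_chars that]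
      rho_pair_Mirabolic_invariant[OF h triv_char_fq_chars that]
      rho_pair_Mirabolic_invariant[OF k _ that]
    by (simp add: recompose_def)
  ultimately show ?thesis
    by (simp add: mem_ind_rep_iff)
qed

lemma GL2_average_recompose:
  fixes y :: "'k::{field,finite} principal_index \<Rightarrow> complex"
  assumes y: "y \<in> fst principal_sum"
  shows "GL2_average (recompose y) = y (Inl ())"
proof -
  have h: "(\<Sum>g\<in>GL2. y (Inr (Inl g))) = 0"
    and k: "\<And>\<phi>. \<phi> \<in> fq_chars - {triv_char} \<Longrightarrow>
      (\<lambda>g. y (Inr (Inr (\<phi>, g)))) \<in> fst (rho_pair \<phi> triv_char)"
    using y by (simp_all add: mem_principal_sum_iff)
  have "(\<Sum>g\<in>GL2. recompose y g) = y (Inl ()) * of_nat (card (GL2 :: ('k^2^2) set))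
      + (\<Sum>\<phi>\<in>fq_chars - {triv_char}. \<Sum>g\<in>GL2. y (Inr (Inr (\<phi>, g))))"
    by (simp add: recompose_def sum.distrib h sum.swap[of _ GL2] flip: sum_distrib_left)
  also have "\<dots> = y (Inl ()) * of_nat (card (GL2 :: ('k^2^2) set))"
    using sum_GL2_rho_pair_nontriv[OF k] by simp
  finally show ?thesis
    using card_GL2_nonzero[where 'k='k] by (simp add: GL2_average_def)
qed

lemma torus_proj_recompose:
  assumes y: "y \<in> fst principal_sum" and \<phi>: "\<phi> \<in> fq_chars"
  shows "torus_proj \<phi> (recompose y) g =
    (if \<phi> = triv_char then y (Inl ()) * of_bool (g \<in> GL2) + y (Inr (Inl g))
     else y (Inr (Inr (\<phi>, g))))"
proof -
  have h: "(\<lambda>g. y (Inr (Inl g))) \<in> fst (rho_pair triv_char triv_char)"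
    and k: "\<And>\<psi>. \<psi> \<in> fq_chars - {triv_char} \<Longrightarrow>
      (\<lambda>g. y (Inr (Inr (\<psi>, g)))) \<in> fst (rho_pair \<psi> triv_char)"
    using y by (simp_all add: mem_principal_sum_iff)
  have "(\<Sum>\<psi>\<in>fq_chars - {triv_char}. torus_proj \<phi> (\<lambda>g. y (Inr (Inr (\<psi>, g)))) g)
      = (\<Sum>\<psi>\<in>fq_chars - {triv_char}. if \<phi> = \<psi> then y (Inr (Inr (\<psi>, g))) else 0)"
    using torus_proj_on_rho_pair[OF k _ \<phi>] by (intro sum.cong) auto
  also have "\<dots> = (if \<phi> = triv_char then 0 else y (Inr (Inr (\<phi>, g))))"
    using \<phi> by (simp add: sum.delta' finite_fq_chars)
  finally show ?thesis
    using torus_proj_on_rho_pair[OF GL2_indicator_rho_pair triv_char_fq_chars \<phi>]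
      torus_proj_on_rho_pair[OF h triv_char_fq_chars \<phi>]
    by (simp add: recompose_def[abs_def] torus_proj_add torus_proj_cmult torus_proj_sum)
qed

lemma decompose_recompose:
  assumes y: "y \<in> fst principal_sum"
  shows "decompose (recompose y) = y"
proof
  fix z
  show "decompose (recompose y) z = y z"
    using y by (cases "(recompose y, z)" rule: decompose.cases)
      (auto simp: GL2_average_recompose torus_proj_recompose triv_char_fq_chars mem_principal_sum_iff)
qed

theorem proposition5p1:
  assumes "CARD('k::{field,finite}) > 2"
  shows "rep_iso (GL2 :: ('k ^ 2 ^ 2) set)
           (ind_rep GL2 (**) Mirabolic (\<lambda>_. 1))
           (dsum2 triv_rep
              (dsum2 (rho_single (triv_char :: 'k \<Rightarrow> complex))
                     (dsum_fam (fq_chars - {triv_char}) (\<lambda>c. rho_pair c triv_char))))"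
proof -
  have "bij_betw decompose (fst mirabolic_rep) (fst (principal_sum :: ('k^2^2, _) crep))"
    by (rule bij_betw_byWitness[where f' = recompose])
      (auto simp: recompose_decompose decompose_recompose decompose_mem recompose_mem)
  then show ?thesis
    unfolding rep_iso_def using decompose_linear decompose_equivariant by blast
qed

end
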